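(* Fix positive integers $\alpha$ and $m$. For every positive integer $k$ and every $\delta>0$ there exists $N_0\ge k$ such that for all $N\ge N_0$ and all $g,h\in \mathrm{S}(\alpha+mk)$ the $\tau_{g,h}$-measure of the double coset $g\circ_N h\subset G_N=\mathrm{S}(\alpha+m(k+N))$ is $>1-\delta$.
   Context: $\mathrm{S}(n)$ is the symmetric group on $n$ letters, realized as the group of $n\times n$ permutation matrices (0-1 matrices); $1_n$ is the identity matrix of size $n$. Put $G_N:=\mathrm{S}(\alpha+m(k+N))$. Its elements are written as block 0-1 matrices of size $\alpha+(k+N)+\dots+(k+N)$ ($m$ blocks of size $k+N$), and each block of size $k+N$ is further subdivided as $k+N$. The group $\mathrm{S}(\alpha+mk)$ is regarded as a subgroup of $G_N$ as follows: an element $\begin{pmatrix} a&b_1&\dots&b_m\\ c_1&d_{11}&\dots&d_{1m}\\ \vdots&\vdots&\ddots&\vdots\\ c_m&d_{m1}&\dots&d_{mm}\end{pmatrix}$ (blocks of sizes $\alpha+k+\dots+k$) is sent to the permutation matrix $$\begin{pmatrix} a&\widetilde b_1&\dots&\widetilde b_m\\ \widetilde c_1&\widetilde d_{11}&\dots&\widetilde d_{1m}\\ \vdots&\vdots&\ddots&\vdots\\ \widetilde c_m&\widetilde d_{m1}&\dots&\widetilde d_{mm}\end{pmatrix},\quad \widetilde b_j=\begin{pmatrix}b_j&0\end{pmatrix},\ \widetilde c_i=\begin{pmatrix}c_i\\0\end{pmatrix},\ \widetilde d_{ii}=\begin{pmatrix}d_{ii}&0\\0&1_N\end{pmatrix},\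 \widetilde d_{ij}=\begin{pmatrix}d_{ij}&0\\0&0\end{pmatrix}\ (i\ne j),$$ i.e. it acts as the identity on the $N$ last letters of each of the $m$ blocks of size $k+N$. The subgroup $K_N\simeq \mathrm{S}(k+N)$ of $G_N$ consists of the block-diagonal matrices $\mathrm{diag}(1_\alpha,x,x,\dots,x)$ with $x\in \mathrm{S}(k+N)$ repeated $m$ times. Let $\kappa_N$ be the uniform probability distribution on $K_N$, regarded as a measure on $G_N$, and let $\delta_g$ be the unit point mass at $g$. For $g,h\in \mathrm{S}(\alpha+mk)$ define the probability measure on $G_N$ $$\tau_{g,h}:=\kappa_N*\delta_g*\kappa_N*\delta_h*\kappa_N,$$ where $*$ is convolution of measures on the group $G_N$. For $N\ge k$ let $J_N:=\mathrm{diag}(1_\alpha,s,s,\dots,s)\in G_N$ ($s$ repeated $m$ times), where $$s:=\begin{pmatrix}0&1_k&0\\1_k&0&0\\0&0&1_{N-k}\end{pmatrix}\in \mathrm{S}(k+N).$$ For $g,h\in \mathrm{S}(\alpha+mk)\subset G_N$ the element $g\circ_N h\in K_N\setminus G_N/K_N$ is the double coset $$g\circ_N h:=K_N\, gJ_Nh\, K_N .$$ *)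

theory Defs
  imports
    "HOL-Algebra.Sym_Groups"
    "HOL-Algebra.Coset"
    "HOL-Probability.Probability_Mass_Function"
begin

text \<open>
  A permutation \<open>p\<close> of \<open>{1..n}\<close> stands for the permutation matrix with
  entry \<open>1\<close> at \<open>(p j, j)\<close>, so that matrix multiplication is composition.
  The letters \<open>{1..\<alpha> + m * n}\<close> are split into blocks of sizes \<open>\<alpha>, n, \<dots>, n\<close>;
  the \<open>n\<close>-blocks are numbered \<open>i = 0, \<dots>, m - 1\<close>, and the letters inside an
  \<open>n\<close>-block are numbered \<open>j = 1, \<dots>, n\<close>.
\<close>

definition block_letter :: "nat \<Rightarrow> nat \<Rightarrow> nat \<Rightarrow> nat \<Rightarrow> nat" where
  "block_letter \<alpha> n i j = \<alpha> + i * n + j"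

definition block_of :: "nat \<Rightarrow> nat \<Rightarrow> nat \<Rightarrow> nat" where
  "block_of \<alpha> n l = (l - \<alpha> - 1) div n"

definition pos_of :: "nat \<Rightarrow> nat \<Rightarrow> nat \<Rightarrow> nat" where
  "pos_of \<alpha> n l = (l - \<alpha> - 1) mod n + 1"

lemma block_of_block_letter [simp]:
  "j \<in> {1..n} \<Longrightarrow> block_of \<alpha> n (block_letter \<alpha> n i j) = i"
  by (cases j) (auto simp: block_of_def block_letter_def div_add1_eq)

lemma pos_of_block_letter [simp]:
  "j \<in> {1..n} \<Longrightarrow> pos_of \<alpha> n (block_letter \<alpha> n i j) = j"
  by (cases j) (auto simp: pos_of_def block_letter_def)

text \<open>The block matrix \<open>diag(1\<^sub>\<alpha>, x, \<dots>, x)\<close> with \<open>m\<close> copies of \<open>x \<in> S(n)\<close>.\<close>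

definition block_diag :: "nat \<Rightarrow> nat \<Rightarrow> nat \<Rightarrow> (nat \<Rightarrow> nat) \<Rightarrow> nat \<Rightarrow> nat" where
  "block_diag \<alpha> m n x l =
     (if l \<in> {\<alpha> + 1..\<alpha> + m * n}
      then block_letter \<alpha> n (block_of \<alpha> n l) (x (pos_of \<alpha> n l)) else l)"

lemma block_diag_letter:
  assumes "i < m" "j \<in> {1..n}"
  shows "block_diag \<alpha> m n x (block_letter \<alpha> n i j) = block_letter \<alpha> n i (x j)"
proof -
  have "i * n + j \<le> m * n" using assms
    by (metis Suc_leI atLeastAtMost_iff add.commute mult_Suc mult_le_mono1 add_le_mono1 le_trans)
  then show ?thesis using assms by (auto simp: block_diag_def) (auto simp: block_letter_def)
qed
lemma block_diag_alpha: "l \<le> \<alpha> \<Longrightarrow> block_diag \<alpha> m n x l = l" by (simp add: block_diag_def)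

definition big_group :: "nat \<Rightarrow> nat \<Rightarrow> nat \<Rightarrow> nat \<Rightarrow> (nat \<Rightarrow> nat) monoid" where
  "big_group \<alpha> m k N = sym_group (\<alpha> + m * (k + N))"

text \<open>
  The inclusion of \<open>S(\<alpha> + m * k)\<close> into \<open>S(\<alpha> + m * (k + N))\<close>: the letters of the
  small group are placed at the first \<open>k\<close> positions of the blocks of size \<open>k + N\<close>
  (and \<open>map_permutation\<close> is the identity on all remaining letters).
\<close>

definition embed_letter :: "nat \<Rightarrow> nat \<Rightarrow> nat \<Rightarrow> nat \<Rightarrow> nat" where
  "embed_letter \<alpha> k N l =
     (if l \<le> \<alpha> then l else block_letter \<alpha> (k + N) (block_of \<alpha> k l) (pos_of \<alpha> k l))"

definition embed :: "nat \<Rightarrow> nat \<Rightarrow> nat \<Rightarrow> nat \<Rightarrow> (nat \<Rightarrow> nat) \<Rightarrow> nat \<Rightarrow> nat" where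
  "embed \<alpha> m k N g = map_permutation {1..\<alpha> + m * k} (embed_letter \<alpha> k N) g"

lemma block_letter_decomp: "l > \<alpha> \<Longrightarrow> block_letter \<alpha> n (block_of \<alpha> n l) (pos_of \<alpha> n l) = l"
  by (simp add: block_letter_def block_of_def pos_of_def)

lemma embed_letter_block_letter: "j \<in> {1..k} \<Longrightarrow> embed_letter \<alpha> k N (block_letter \<alpha> k i j) = block_letter \<alpha> (k+N) i j"
  by (simp add: embed_letter_def) (simp add: block_letter_def)

lemma pos_of_bound: "n > 0 \<Longrightarrow> pos_of \<alpha> n l \<in> {1..n}" by (simp add: pos_of_def Suc_leI)

lemma inj_embed_letter: assumes "k > 0" shows "inj (embed_letter \<alpha> k N)"
proof (rule injI)
  fix x y assume e: "embed_letter \<alpha> k N x = embed_letter \<alpha> k N y"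
  have g: "embed_letter \<alpha> k N z > \<alpha>" if "z > \<alpha>" for z using that
    by (simp add: embed_letter_def block_letter_def pos_of_def)
  show "x = y"
  proof (cases "x \<le> \<alpha> \<or> y \<le> \<alpha>")
    case True then show ?thesis using e g[of x] g[of y]
      by (metis embed_letter_def leD linorder_le_less_linear)
  next
    case False
    have p: "pos_of \<alpha> k z \<in> {1..k+N}" for z using pos_of_bound[OF assms, of \<alpha> z] by auto
    from e False have e': "block_letter \<alpha> (k + N) (block_of \<alpha> k x) (pos_of \<alpha> k x) = block_letter \<alpha> (k + N) (block_of \<alpha> k y) (pos_of \<alpha> k y)"
      by (simp add: embed_letter_def)
    have "pos_of \<alpha> k x = pos_of \<alpha> k y" "block_of \<alpha> k x = block_of \<alpha> k y"
      using e' p by (metis pos_of_block_letter, metis block_of_block_letter p e')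
    then show ?thesis using False block_letter_decomp by (metis not_le)
  qed
qed

lemma embed_apply: assumes "k>0" "l \<in> {1..\<alpha>+m*k}"
  shows "embed \<alpha> m k N g (embed_letter \<alpha> k N l) = embed_letter \<alpha> k N (g l)"
  unfolding embed_def by (rule map_permutation_apply) (use inj_embed_letter[OF assms(1)] assms in \<open>auto intro: inj_on_subset\<close>)

lemma embed_outside: assumes "k>0" "j \<in> {k+1..k+N}"
  shows "embed \<alpha> m k N g (block_letter \<alpha> (k+N) i j) = block_letter \<alpha> (k+N) i j"
proof -
  have "block_letter \<alpha> (k+N) i j \<noteq> embed_letter \<alpha> k N l" for l
  proof
    assume e: "block_letter \<alpha> (k+N) i j = embed_letter \<alpha> k N l"
    show False
    proof (cases "l \<le> \<alpha>")
      case True then show False using e assms by (simp add: embed_letter_def block_letter_def)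
    next
      case False
      have b: "pos_of \<alpha> k l \<in> {1..k}" using pos_of_bound assms by blast
      have "j = pos_of \<alpha> k l"
        using arg_cong[OF e, of "pos_of \<alpha> (k+N)"] False assms b by (simp add: embed_letter_def)
      then show False using b assms by simp
    qed
  qed
  then show ?thesis by (auto simp: embed_def map_permutation_def restrict_id_def)
qed

definition diag_subgroup :: "nat \<Rightarrow> nat \<Rightarrow> nat \<Rightarrow> nat \<Rightarrow> (nat \<Rightarrow> nat) set" where
  "diag_subgroup \<alpha> m k N = block_diag \<alpha> m (k + N) ` carrier (sym_group (k + N))"

text \<open>The involution \<open>s\<close> exchanging the first \<open>k\<close> letters with the next \<open>k\<close> letters.\<close>

definition swap_perm :: "nat \<Rightarrow> nat \<Rightarrow> nat" where
  "swap_perm k j =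
     (if j \<in> {1..k} then j + k else if j \<in> {k + 1..2 * k} then j - k else j)"

lemma swap_perm_carrier: "k \<le> N \<Longrightarrow> swap_perm k \<in> carrier (sym_group (k+N))"
  unfolding sym_group_carrier
  by (rule bij_imp_permutes, rule bij_betw_byWitness[where f'="swap_perm k"]) (auto simp: swap_perm_def)

definition J_elem :: "nat \<Rightarrow> nat \<Rightarrow> nat \<Rightarrow> nat \<Rightarrow> nat \<Rightarrow> nat" where
  "J_elem \<alpha> m k N = block_diag \<alpha> m (k + N) (swap_perm k)"

text \<open>Convolution of finitely (or countably) supported probability measures on a group.\<close>

definition conv_pmf :: "('a, 'b) monoid_scheme \<Rightarrow> 'a pmf \<Rightarrow> 'a pmf \<Rightarrow> 'a pmf" where
  "conv_pmf G \<mu> \<nu> = map_pmf (\<lambda>(x, y). x \<otimes>\<^bsub>G\<^esub> y) (pair_pmf \<mu> \<nu>)"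

definition kappa :: "nat \<Rightarrow> nat \<Rightarrow> nat \<Rightarrow> nat \<Rightarrow> (nat \<Rightarrow> nat) pmf" where
  "kappa \<alpha> m k N = pmf_of_set (diag_subgroup \<alpha> m k N)"

definition tau ::
  "nat \<Rightarrow> nat \<Rightarrow> nat \<Rightarrow> nat \<Rightarrow> (nat \<Rightarrow> nat) \<Rightarrow> (nat \<Rightarrow> nat) \<Rightarrow> (nat \<Rightarrow> nat) pmf" where
  "tau \<alpha> m k N g h =
     (let conv = conv_pmf (big_group \<alpha> m k N);
          \<kappa> = kappa \<alpha> m k N;
          \<delta> = (\<lambda>x. return_pmf (embed \<alpha> m k N x))
      in conv (conv (conv (conv \<kappa> (\<delta> g)) \<kappa>) (\<delta> h)) \<kappa>)"

definition double_coset :: "('a, 'b) monoid_scheme \<Rightarrow> 'a set \<Rightarrow> 'a \<Rightarrow> 'a set" where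
  "double_coset G K x = K <#>\<^bsub>G\<^esub> {x} <#>\<^bsub>G\<^esub> K"

definition circ ::
  "nat \<Rightarrow> nat \<Rightarrow> nat \<Rightarrow> nat \<Rightarrow> (nat \<Rightarrow> nat) \<Rightarrow> (nat \<Rightarrow> nat) \<Rightarrow> (nat \<Rightarrow> nat) set" where
  "circ \<alpha> m k N g h =
     (let G = big_group \<alpha> m k N in
      double_coset G (diag_subgroup \<alpha> m k N)
        (embed \<alpha> m k N g \<otimes>\<^bsub>G\<^esub> J_elem \<alpha> m k N \<otimes>\<^bsub>G\<^esub> embed \<alpha> m k N h))"

end

theory Submission
  imports Defs
begin

text \<open>
  Write \<open>D x = diag(1, x, \<dots>, x)\<close> for \<open>x \<in> S(k + N)\<close>. A sample of \<open>\<tau>\<^sub>g\<^sub>,\<^sub>h\<close> is a product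
  \<open>D a \<cdot> g \<cdot> D x \<cdot> h \<cdot> D b\<close> with \<open>a\<close>, \<open>x\<close>, \<open>b\<close> independent and uniform, and only the middle
  factor decides whether it falls into \<open>K g J h K\<close>.

  The map \<open>D\<close> is a homomorphism, and the elements \<open>g\<close> and \<open>h\<close> move only letters at the first
  \<open>k\<close> positions of the blocks. Hence they commute with \<open>D u\<close> as soon as \<open>u\<close> fixes \<open>1, \<dots>, k\<close>
  (\<open>embed_block_diag_commute\<close>). So if \<open>x = u s v\<close>, where \<open>u\<close> and \<open>v\<close> fix \<open>1, \<dots>, k\<close>, then
  \<open>g \<cdot> D x \<cdot> h = D u \<cdot> g \<cdot> J \<cdot> h \<cdot> D v\<close>, and the sample lies in the double coset.

  Such a factorization exists whenever \<open>x\<close> maps \<open>{1..k}\<close> off itself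
  (\<open>separating_permutation_factors\<close>). For uniform \<open>x\<close> each of the \<open>k\<^sup>2\<close> events \<open>x i = j\<close> with
  \<open>i, j \<le> k\<close> has probability \<open>1 / (k + N)\<close>, so by the union bound the factorization fails with
  probability at most \<open>k\<^sup>2 / (k + N)\<close>. This tends to \<open>0\<close>, and it does not depend on \<open>g\<close> and \<open>h\<close>.
\<close>

section \<open>Permutations with prescribed values\<close>

lemma inj_on_extends_to_permutation:
  assumes "finite S" "A \<subseteq> S" "inj_on f A" "f ` A \<subseteq> S"
  obtains p where "p permutes S" "\<And>a. a \<in> A \<Longrightarrow> p a = f a"
proof -
  have "card (S - A) = card (S - f ` A)"
    using assms by (simp add: card_Diff_subset finite_subset card_image)
  then obtain q where q: "bij_betw q (S - A) (S - f ` A)"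
    using finite_same_card_bij assms(1) by (metis finite_Diff)
  define p where "p x = (if x \<in> A then f x else if x \<in> S then q x else x)" for x
  have "bij_betw p A (f ` A)"
    using assms(3) by (simp add: p_def bij_betw_def inj_on_def)
  moreover have "bij_betw p (S - A) (S - f ` A)"
    using q by (subst bij_betw_cong[where g = q]) (auto simp: p_def)
  ultimately have "bij_betw p (A \<union> (S - A)) (f ` A \<union> (S - f ` A))"
    by (rule bij_betw_combine) auto
  then have "bij_betw p S S"
    using assms(2,4) by (simp add: Un_absorb1)
  moreover have "p x = x" if "x \<notin> S" for x
    using that assms(2) by (auto simp: p_def)
  ultimately have "p permutes S"
    by (rule bij_imp_permutes)
  then show thesis
    by (rule that) (simp add: p_def)
qed

text \<open>
  Composing with a transposition permutes the possible values of \<open>p i\<close>, so the classes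
  \<open>{p. p i = j}\<close>, for \<open>j \<in> A\<close>, all have the same size.
\<close>

lemma card_permutations_with_value:
  assumes "finite A" "i \<in> A" "j \<in> A"
  shows "card {p. p permutes A \<and> p i = j} * card A = card {p. p permutes A}"
proof -
  let ?C = "\<lambda>j. {p. p permutes A \<and> p i = j}"
  have same: "card (?C j') = card (?C j)" if "j' \<in> A" for j'
  proof -
    let ?t = "Transposition.transpose j j'"
    have t: "?t permutes A"
      by (rule permutes_swap_id[OF assms(3) that])
    have tt: "?t \<circ> (?t \<circ> p) = p" for p :: "'a \<Rightarrow> 'a"
      by (simp add: o_assoc)
    have "bij_betw (\<lambda>p. ?t \<circ> p) (?C j') (?C j)"
      by (rule bij_betwI[where g = "\<lambda>p. ?t \<circ> p"]) (simp_all add: tt permutes_compose[OF _ t])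
    then show ?thesis by (rule bij_betw_same_card)
  qed
  have "{p. p permutes A} = (\<Union>j'\<in>A. ?C j')"
    using assms(2) by (auto simp: permutes_in_image)
  also have "card \<dots> = (\<Sum>j'\<in>A. card (?C j'))"
    using assms(1) finite_permutations[OF assms(1)] by (intro card_UN_disjoint) auto
  also have "\<dots> = (\<Sum>j'\<in>A. card (?C j))"
    using same by (intro sum.cong) auto
  finally show ?thesis by (simp add: mult.commute)
qed

lemma prob_permutation_value:
  assumes "finite A" "i \<in> A" "j \<in> A"
  shows "measure_pmf.prob (pmf_of_set {p. p permutes A}) {p. p i = j} = 1 / card A"
proof -
  have fin: "finite {p. p permutes A}"
    by (rule finite_permutations[OF assms(1)])
  have ne: "{p. p permutes A} \<noteq> {}"
    using permutes_id by blast
  have "card A > 0" "card {p. p permutes A} > 0"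
    using assms fin ne by (auto simp: card_gt_0_iff)
  moreover have "real (card {p. p permutes A \<and> p i = j}) * card A = card {p. p permutes A}"
    unfolding of_nat_mult[symmetric] card_permutations_with_value[OF assms] by (rule refl)
  moreover have "{p. p permutes A} \<inter> {p. p i = j} = {p. p permutes A \<and> p i = j}"
    by auto
  ultimately show ?thesis
    by (simp add: measure_pmf_of_set[OF ne fin] field_simps)
qed

lemma prob_permutation_separates:
  assumes "finite A" "B \<subseteq> A"
  shows "measure_pmf.prob (pmf_of_set {p. p permutes A}) {p. p ` B \<inter> B = {}}
           \<ge> 1 - (card B)\<^sup>2 / card A"
proof -
  let ?P = "pmf_of_set {p. p permutes A}"
  have "finite B" using assms finite_subset by blast
  have "- {p. p ` B \<inter> B = {}} = (\<Union>(i, j)\<in>B \<times> B. {p. p i = j})"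
    by blast
  then have "measure_pmf.prob ?P (- {p. p ` B \<inter> B = {}})
          = measure_pmf.prob ?P (\<Union>(i, j)\<in>B \<times> B. {p. p i = j})"
    by (rule arg_cong)
  also have "\<dots> \<le> (\<Sum>z\<in>B \<times> B. measure_pmf.prob ?P (case z of (i, j) \<Rightarrow> {p. p i = j}))"
    using \<open>finite B\<close> by (intro measure_pmf.finite_measure_subadditive_finite) auto
  also have "\<dots> = (\<Sum>z\<in>B \<times> B. 1 / card A)"
    using assms by (intro sum.cong) (auto intro!: prob_permutation_value)
  also have "\<dots> = (card B)\<^sup>2 / card A"
    by (simp add: card_cartesian_product power2_eq_square)
  finally show ?thesis
    using measure_pmf.prob_compl[of "{p. p ` B \<inter> B = {}}" ?P] by (simp add: Compl_eq_Diff_UNIV)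
qed

section \<open>Factoring through the swap\<close>

text \<open>
  The factor \<open>u\<close> must fix \<open>{1..k}\<close> and agree with \<open>x \<circ> s\<close> on \<open>{k + 1..2 * k}\<close>. These two
  requirements are jointly injective because \<open>x\<close> maps \<open>{1..k}\<close> off itself. The factor \<open>v\<close> is
  then forced to be \<open>s\<inverse> u\<inverse> x\<close>, and it fixes \<open>{1..k}\<close> because \<open>u \<circ> s\<close> agrees with \<open>x\<close> there.
\<close>

lemma separating_permutation_factors:
  assumes "k \<le> N" and x: "x permutes {1..k + N}" and sep: "x ` {1..k} \<inter> {1..k} = {}"
  obtains u v where "u permutes {1..k + N}" "v permutes {1..k + N}"
    "\<And>j. j \<in> {1..k} \<Longrightarrow> u j = j" "\<And>j. j \<in> {1..k} \<Longrightarrow> v j = j"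
    "x = u \<circ> swap_perm k \<circ> v"
proof -
  define f where "f j = (if j \<le> k then j else x (j - k))" for j
  have sep': "x j \<noteq> i" if "j \<in> {1..k}" "i \<in> {1..k}" for i j
    using sep that by blast
  have "inj_on f {1..2 * k}"
  proof (rule inj_onI)
    fix i j assume ij: "i \<in> {1..2 * k}" "j \<in> {1..2 * k}" "f i = f j"
    have "x (i - k) = x (j - k) \<Longrightarrow> i - k = j - k"
      using permutes_inj[OF x] by (auto dest: injD)
    moreover have "f a \<noteq> f b" if "k < a" "a \<in> {1..2 * k}" "b \<in> {1..k}" for a b
    proof -
      have "a - k \<in> {1..k}" using that by auto
      then show ?thesis using sep'[of "a - k" b] that by (simp add: f_def)
    qed
    then have "i \<le> k \<longleftrightarrow> j \<le> k"
      using ij by (metis atLeastAtMost_iff not_le)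
    ultimately show "i = j" using ij by (auto simp: f_def split: if_splits)
  qed
  moreover have "f j \<in> {1..k + N}" if "j \<in> {1..2 * k}" for j
    using that assms(1) permutes_in_image[OF x, of "j - k"] by (auto simp: f_def)
  then have "f ` {1..2 * k} \<subseteq> {1..k + N}" by blast
  ultimately obtain u where u: "u permutes {1..k + N}"
    and uf: "\<And>j. j \<in> {1..2 * k} \<Longrightarrow> u j = f j"
    using inj_on_extends_to_permutation[of "{1..k + N}" "{1..2 * k}" f] assms(1) by auto
  have s: "swap_perm k permutes {1..k + N}"
    using swap_perm_carrier[OF assms(1)] by (simp add: sym_group_carrier)
  have us: "u \<circ> swap_perm k permutes {1..k + N}"
    by (rule permutes_compose[OF s u])
  define v where "v = inv_into UNIV (u \<circ> swap_perm k) \<circ> x"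
  show thesis
  proof (rule that)
    show "u permutes {1..k + N}" by (rule u)
    show "v permutes {1..k + N}"
      unfolding v_def by (rule permutes_compose[OF x permutes_inv[OF us]])
    show "u j = j" if "j \<in> {1..k}" for j
      using that uf[of j] by (simp add: f_def)
    show "v j = j" if "j \<in> {1..k}" for j
    proof -
      have "(u \<circ> swap_perm k) j = x j"
        using that uf[of "j + k"] by (simp add: f_def swap_perm_def)
      then show ?thesis
        unfolding v_def by (metis comp_apply inv_f_f permutes_inj[OF us])
    qed
    show "x = u \<circ> swap_perm k \<circ> v"
      unfolding v_def by (simp add: o_assoc permutes_inv_o[OF us])
  qed
qed

section \<open>The block-diagonal homomorphism\<close>

lemma block_letter_cases:
  assumes "l \<in> {\<alpha> + 1..\<alpha> + m * n}"
  obtains i j where "i < m" "j \<in> {1..n}" "l = block_letter \<alpha> n i j"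
proof (rule that)
  have n: "n > 0" using assms by (cases n) auto
  show "block_of \<alpha> n l < m"
    using assms n by (auto simp: block_of_def less_mult_imp_div_less)
  show "pos_of \<alpha> n l \<in> {1..n}" by (rule pos_of_bound[OF n])
  show "l = block_letter \<alpha> n (block_of \<alpha> n l) (pos_of \<alpha> n l)"
    using assms by (simp add: block_letter_decomp)
qed

lemma block_diag_compose:
  assumes "v permutes {1..n}"
  shows "block_diag \<alpha> m n (u \<circ> v) = block_diag \<alpha> m n u \<circ> block_diag \<alpha> m n v"
proof
  fix l
  show "block_diag \<alpha> m n (u \<circ> v) l = (block_diag \<alpha> m n u \<circ> block_diag \<alpha> m n v) l"
  proof (cases "l \<in> {\<alpha> + 1..\<alpha> + m * n}")
    case True
    then obtain i j where "i < m" "j \<in> {1..n}" "l = block_letter \<alpha> n i j"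
      by (rule block_letter_cases)
    moreover have "v j \<in> {1..n}"
      using \<open>j \<in> {1..n}\<close> permutes_in_image[OF assms] by blast
    ultimately show ?thesis by (simp only: block_diag_letter comp_apply)
  next
    case False
    then have "block_diag \<alpha> m n w l = l" for w by (simp only: block_diag_def if_False)
    then show ?thesis by simp
  qed
qed

lemma block_diag_id: "block_diag \<alpha> m n id = id"
  by (auto simp: fun_eq_iff block_diag_def block_letter_decomp)

lemma inj_block_diag:
  assumes "u permutes {1..n}"
  shows "inj (block_diag \<alpha> m n u)"
proof -
  have "block_diag \<alpha> m n (inv_into UNIV u) \<circ> block_diag \<alpha> m n u = id"
    using block_diag_compose[OF assms, of \<alpha> m "inv_into UNIV u"]
    by (simp add: permutes_inv_o[OF assms] block_diag_id)
  then show ?thesis by (metis inj_on_id inj_on_imageI2)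
qed

lemma inj_on_block_diag:
  assumes "m > 0"
  shows "inj_on (block_diag \<alpha> m n) {p. p permutes {1..n}}"
proof (rule inj_onI, rule ext)
  fix x y j
  assume xy: "x \<in> {p. p permutes {1..n}}" "y \<in> {p. p permutes {1..n}}"
    and eq: "block_diag \<alpha> m n x = block_diag \<alpha> m n y"
  show "x j = y j"
  proof (cases "j \<in> {1..n}")
    case True
    have "block_letter \<alpha> n 0 (x j) = block_letter \<alpha> n 0 (y j)"
      using block_diag_letter[OF assms True, of \<alpha>] eq by metis
    then show ?thesis by (simp add: block_letter_def)
  next
    case False
    then show ?thesis using xy by (auto simp: permutes_not_in)
  qed
qed

lemma permutes_commutes_with_fixing:
  assumes "p permutes E" "inj f" "\<And>e. e \<in> E \<Longrightarrow> f e = e"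
  shows "p \<circ> f = f \<circ> p"
proof
  fix x
  show "(p \<circ> f) x = (f \<circ> p) x"
  proof (cases "x \<in> E")
    case True
    then show ?thesis using assms by (simp add: permutes_in_image)
  next
    case False
    \<comment> \<open>If \<open>f x\<close> were in \<open>E\<close>, it would be fixed, and injectivity would give \<open>f x = x\<close>.\<close>
    then have "f x \<notin> E" using assms(2,3) by (metis injD)
    then show ?thesis using False assms(1) by (simp add: permutes_not_in)
  qed
qed

lemma embed_block_diag_commute:
  assumes "k > 0" "g permutes {1..\<alpha> + m * k}" "u permutes {1..k + N}"
    and fix_k: "\<And>j. j \<in> {1..k} \<Longrightarrow> u j = j"
  shows "embed \<alpha> m k N g \<circ> block_diag \<alpha> m (k + N) u
           = block_diag \<alpha> m (k + N) u \<circ> embed \<alpha> m k N g"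
proof (rule permutes_commutes_with_fixing)
  let ?E = "embed_letter \<alpha> k N ` {1..\<alpha> + m * k}"
  have "inj_on (embed_letter \<alpha> k N) {1..\<alpha> + m * k}"
    using inj_embed_letter[OF assms(1)] by (rule inj_on_subset) simp
  then show "embed \<alpha> m k N g permutes ?E"
    unfolding embed_def by (intro map_permutation_permutes assms(2)) (simp add: bij_betw_def)
  show "inj (block_diag \<alpha> m (k + N) u)"
    by (rule inj_block_diag[OF assms(3)])
  fix e assume "e \<in> ?E"
  then obtain l where l: "l \<in> {1..\<alpha> + m * k}" "e = embed_letter \<alpha> k N l"
    by blast
  show "block_diag \<alpha> m (k + N) u e = e"
  proof (cases "l \<le> \<alpha>")
    case True
    then show ?thesis using l by (simp add: embed_letter_def block_diag_alpha)
  next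
    case False
    with l obtain i j where ij: "i < m" "j \<in> {1..k}" "l = block_letter \<alpha> k i j"
      using block_letter_cases[of l \<alpha> m k] by auto
    then have "e = block_letter \<alpha> (k + N) i j"
      using l embed_letter_block_letter by simp
    then show ?thesis
      using ij fix_k block_diag_letter[of i m j "k + N" \<alpha> u] by simp
  qed
qed

section \<open>Reduction to the middle factor\<close>

lemma product_in_circ:
  assumes "k > 0" "k \<le> N"
    and g: "g permutes {1..\<alpha> + m * k}" and h: "h permutes {1..\<alpha> + m * k}"
    and a: "a permutes {1..k + N}" and b: "b permutes {1..k + N}"
    and x: "x permutes {1..k + N}" "x ` {1..k} \<inter> {1..k} = {}"
  defines "D \<equiv> block_diag \<alpha> m (k + N)"
  shows "D a \<circ> embed \<alpha> m k N g \<circ> D x \<circ> embed \<alpha> m k N h \<circ> D b \<in> circ \<alpha> m k N g h"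
proof -
  let ?g = "embed \<alpha> m k N g" and ?h = "embed \<alpha> m k N h" and ?J = "J_elem \<alpha> m k N"
  obtain u v where u: "u permutes {1..k + N}" "\<And>j. j \<in> {1..k} \<Longrightarrow> u j = j"
    and v: "v permutes {1..k + N}" "\<And>j. j \<in> {1..k} \<Longrightarrow> v j = j"
    and xuv: "x = u \<circ> swap_perm k \<circ> v"
    using separating_permutation_factors[OF assms(2) x] by metis
  have s: "swap_perm k permutes {1..k + N}"
    using swap_perm_carrier[OF assms(2)] by (simp add: sym_group_carrier)
  have Dx: "D x = D u \<circ> ?J \<circ> D v"
    unfolding xuv D_def J_elem_def by (simp only: block_diag_compose[OF v(1)] block_diag_compose[OF s])
  have gu: "?g \<circ> D u = D u \<circ> ?g"
    unfolding D_def by (rule embed_block_diag_commute[OF assms(1) g u])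
  have vh: "?h \<circ> D v = D v \<circ> ?h"
    unfolding D_def by (rule embed_block_diag_commute[OF assms(1) h v])
  have "D a \<circ> ?g \<circ> D x \<circ> ?h \<circ> D b = D a \<circ> (?g \<circ> D u) \<circ> ?J \<circ> (D v \<circ> ?h) \<circ> D b"
    by (simp only: Dx o_assoc)
  also have "\<dots> = (D a \<circ> D u) \<circ> (?g \<circ> ?J \<circ> ?h) \<circ> (D v \<circ> D b)"
    unfolding gu vh[symmetric] by (simp only: o_assoc)
  also have "\<dots> = D (a \<circ> u) \<circ> (?g \<circ> ?J \<circ> ?h) \<circ> D (v \<circ> b)"
    unfolding D_def by (simp only: block_diag_compose[OF u(1)] block_diag_compose[OF b])
  finally have eq: "D a \<circ> ?g \<circ> D x \<circ> ?h \<circ> D b = \<dots>" .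
  have "D (a \<circ> u) \<in> diag_subgroup \<alpha> m k N" "D (v \<circ> b) \<in> diag_subgroup \<alpha> m k N"
    unfolding diag_subgroup_def D_def
    using permutes_compose[OF u(1) a] permutes_compose[OF b v(1)]
    by (simp_all add: sym_group_carrier)
  then show ?thesis
    unfolding eq circ_def double_coset_def set_mult_def big_group_def sym_group_mult Let_def
    by blast
qed

lemma kappa_eq:
  assumes "m > 0"
  shows "kappa \<alpha> m k N = map_pmf (block_diag \<alpha> m (k + N)) (pmf_of_set {p. p permutes {1..k + N}})"
proof -
  have "carrier (sym_group (k + N)) = {p. p permutes {1..k + N}}"
    by (auto simp: sym_group_carrier)
  moreover have "{p. p permutes {1..k + N}} \<noteq> {}"
    using permutes_id by blast
  moreover have "finite {p. p permutes {1..k + N}}"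
    by (simp add: finite_permutations)
  ultimately show ?thesis
    unfolding kappa_def diag_subgroup_def
    using map_pmf_of_set_inj[OF inj_on_block_diag[OF assms]] by metis
qed

lemma tau_eq:
  fixes \<alpha> m k N :: nat
  assumes "m > 0"
  defines "D \<equiv> block_diag \<alpha> m (k + N)" and "U \<equiv> pmf_of_set {p. p permutes {1..k + N}}"
  shows "tau \<alpha> m k N g h =
           map_pmf (\<lambda>((a, x), b). D a \<circ> embed \<alpha> m k N g \<circ> D x \<circ> embed \<alpha> m k N h \<circ> D b)
             (pair_pmf (pair_pmf U U) U)"
  unfolding tau_def Let_def conv_pmf_def big_group_def sym_group_mult kappa_eq[OF assms(1)]
    D_def U_def pair_pmf_def map_pmf_def
  by (simp add: bind_assoc_pmf bind_return_pmf)

lemma prob_tau_circ_ge: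
  assumes "m > 0" "k > 0" "k \<le> N"
    and g: "g permutes {1..\<alpha> + m * k}" and h: "h permutes {1..\<alpha> + m * k}"
  shows "measure_pmf.prob (tau \<alpha> m k N g h) (circ \<alpha> m k N g h) \<ge> 1 - k\<^sup>2 / (k + N)"
proof -
  define U where "U = pmf_of_set {p. p permutes {1..k + N}}"
  define D where "D = block_diag \<alpha> m (k + N)"
  define F where
    "F = (\<lambda>((a, x), b). D a \<circ> embed \<alpha> m k N g \<circ> D x \<circ> embed \<alpha> m k N h \<circ> D b)"
  define Q where "Q = pair_pmf (pair_pmf U U) U"
  define S where "S = {p::nat \<Rightarrow> nat. p ` {1..k} \<inter> {1..k} = {}}"
  have "{p::nat \<Rightarrow> nat. p permutes {1..k + N}} \<noteq> {}"
    using permutes_id by blast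
  then have setU: "set_pmf U = {p. p permutes {1..k + N}}"
    unfolding U_def by (simp add: finite_permutations)
  have "1 - k\<^sup>2 / (k + N) \<le> measure_pmf.prob U S"
    using prob_permutation_separates[of "{1..k + N}" "{1..k}"] by (simp add: U_def S_def)
  also have "\<dots> = measure_pmf.prob (map_pmf (snd \<circ> fst) Q) S"
    unfolding Q_def by (simp add: map_fst_pair_pmf map_snd_pair_pmf flip: pmf.map_comp)
  also have "\<dots> = measure_pmf.prob Q ((snd \<circ> fst) -` S)"
    by simp
  also have "\<dots> = measure_pmf.prob Q ((snd \<circ> fst) -` S \<inter> set_pmf Q)"
    by (simp only: measure_Int_set_pmf)
  also have "\<dots> \<le> measure_pmf.prob Q (F -` circ \<alpha> m k N g h)"
  proof (rule measure_pmf.finite_measure_mono)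
    show "(snd \<circ> fst) -` S \<inter> set_pmf Q \<subseteq> F -` circ \<alpha> m k N g h"
    proof
      fix z assume z: "z \<in> (snd \<circ> fst) -` S \<inter> set_pmf Q"
      obtain a x b where "z = ((a, x), b)" by (metis prod.exhaust)
      with z show "z \<in> F -` circ \<alpha> m k N g h"
        using product_in_circ[OF assms(2,3) g h, of a b x]
        by (simp add: Q_def setU S_def F_def D_def)
    qed
  qed simp
  also have "\<dots> = measure_pmf.prob (tau \<alpha> m k N g h) (circ \<alpha> m k N g h)"
    unfolding tau_eq[OF assms(1)] F_def D_def Q_def U_def by simp
  finally show ?thesis by simp
qed

theorem theorem4p1:
  fixes \<alpha> m :: nat
  assumes "\<alpha> > 0" and "m > 0"
  shows "\<forall>k::nat. k > 0 \<longrightarrow> (\<forall>\<delta>::real. \<delta> > 0 \<longrightarrow>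
           (\<exists>N\<^sub>0\<ge>k. \<forall>N\<ge>N\<^sub>0.
              \<forall>g \<in> carrier (sym_group (\<alpha> + m * k)). \<forall>h \<in> carrier (sym_group (\<alpha> + m * k)).
                measure_pmf.prob (tau \<alpha> m k N g h) (circ \<alpha> m k N g h) > 1 - \<delta>))"
proof (intro allI impI)
  fix k :: nat and \<delta> :: real
  assume k: "k > 0" and \<delta>: "\<delta> > 0"
  obtain M :: nat where M: "k\<^sup>2 / \<delta> < M"
    using reals_Archimedean2 by blast
  show "\<exists>N\<^sub>0\<ge>k. \<forall>N\<ge>N\<^sub>0.
          \<forall>g \<in> carrier (sym_group (\<alpha> + m * k)). \<forall>h \<in> carrier (sym_group (\<alpha> + m * k)).
            measure_pmf.prob (tau \<alpha> m k N g h) (circ \<alpha> m k N g h) > 1 - \<delta>"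
  proof (intro exI[of _ "max k M"] conjI allI impI ballI)
    fix N g h
    assume N: "max k M \<le> N"
      and gh: "g \<in> carrier (sym_group (\<alpha> + m * k))" "h \<in> carrier (sym_group (\<alpha> + m * k))"
    have "k\<^sup>2 / \<delta> < k + N" using M N by linarith
    then have "k\<^sup>2 / (k + N) < \<delta>"
      using k \<delta> by (simp add: field_simps)
    moreover have "1 - k\<^sup>2 / (k + N) \<le> measure_pmf.prob (tau \<alpha> m k N g h) (circ \<alpha> m k N g h)"
      using prob_tau_circ_ge[OF assms(2) k, of N g \<alpha> h] N gh by (simp add: sym_group_carrier)
    ultimately show "measure_pmf.prob (tau \<alpha> m k N g h) (circ \<alpha> m k N g h) > 1 - \<delta>"
      by linarith
  qed simp
qed

end
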